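(* Let $\mathsf{n}=4$, let $\mathsf{w}$ and $\mathsf{r}$ be integers with $1\le\mathsf{r}\le\mathsf{w}-1$, and let $\mathsf{L},\mathsf{U}$ be non-negative real numbers such that $$\mathsf{L}\le \Pr\left[\mathrm{rot}(\mathbf{y})=\mathcal{Q}(\mathrm{rot}(\mathbf{x}))\right]\le \mathsf{U},$$ where $\mathbf{x}$ is uniformly distributed in $(\mathbb{F}_2^{\mathsf{w}})^{\mathsf{n}}$ and $\mathbf{y}=\mathcal{Q}(\mathbf{x})$, with $\mathcal{Q}$ the ChaCha quarter round. Let $\mathcal{R}$ be one round of the ChaCha permutation (either a column round or a diagonal round), let $X$ be uniformly distributed among the $\mathsf{n}\times\mathsf{n}$ matrices with entries in $\mathbb{F}_2^{\mathsf{w}}$, and let $Y=\mathcal{R}(X)$. Then $$\mathsf{L}^{\mathsf{n}}\le \Pr\left[\mathrm{rot}(Y)=\mathcal{R}(\mathrm{rot}(X))\right]\le \mathsf{U}^{\mathsf{n}}.$$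
   Context: A $\mathsf{w}$-bit word is an element of $\mathbb{F}_2^{\mathsf{w}}$, identified with an integer in $\{0,\dots,2^{\mathsf{w}}-1\}$. The symbol $\oplus$ is bitwise XOR, $\boxplus$ is addition modulo $2^{\mathsf{w}}$, and $x\lll s$ is the left circular rotation of the $\mathsf{w}$-bit word $x$ by $s$ bits. For a vector $\mathbf{x}$ or a matrix $X$ of $\mathsf{w}$-bit words, $\mathrm{rot}(\mathbf{x})$, $\mathrm{rot}(X)$ denote the result of replacing each entry $x$ by $x\lll\mathsf{r}$ (parallel left circular rotation). ChaCha quarter round: fix non-negative integers $r_1,r_2,r_3,r_4\le \mathsf{w}-1$. Then $(y_0,y_1,y_2,y_3)=\mathcal{Q}(x_0,x_1,x_2,x_3)$ is defined by $b_0=x_0\boxplus x_1$, $b_3=(b_0\oplus x_3)\lll r_1$, $b_2=b_3\boxplus x_2$, $b_1=(b_2\oplus x_1)\lll r_2$, $y_0=b_0\boxplus b_1$, $y_3=(y_0\oplus b_3)\lll r_3$, $y_2=y_3\boxplus b_2$, $y_1=(y_2\oplus b_1)\lll r_4$. For $4\times 4$ matrices $X=(x_{i,j})$, $Y=(y_{i,j})$ of $\mathsf{w}$-bit words with indices in $\{0,1,2,3\}$: the column round $Y=\mathcal{R}^{\mathsf{C}}(X)$ is given by $(y_{0,i},y_{1,i},y_{2,i},y_{3,i})=\mathcal{Q}(x_{0,i},x_{1,i},x_{2,i},x_{3,i})$ for $i=0,1,2,3$; the diagonal round $Y=\mathcal{R}^{\mathsf{D}}(X)$ is given by $(y_{0,i},y_{1,i+1},y_{2,i+2},y_{3,i+3})=\mathcal{Q}(x_{0,i},x_{1,i+1},x_{2,i+2},x_{3,i+3})$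 for $i=0,1,2,3$, with indices modulo $4$. *)

theory Defs
  imports "HOL-Probability.Probability" "HOL-Library.Word"
begin

unbundle bit_operations_syntax

text \<open>
  A word of length $w$ is an element of \<^typ>\<open>'w::len word\<close> with \<open>w = LENGTH('w)\<close>: addition is
  modulo \<open>2 ^ LENGTH('w)\<close>, and \<^const>\<open>word_rotl\<close> is left circular rotation.

  Vectors and matrices are indexed by the numeral type \<open>4\<close>, whose elements are \<open>0, 1, 2, 3\<close> and
  whose arithmetic is modulo 4 (so index arithmetic wraps around and \<open>4 = 0\<close>).  The entry in row \<open>i\<close> and
  column \<open>j\<close> of \<open>X\<close> is \<open>X $ i $ j\<close>.  The library's \<^const>\<open>vector\<close> numbers its entries from 1 and
  would therefore put the last entry at index \<open>0\<close>; it is not used here.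
\<close>

definition rot_vec :: "nat \<Rightarrow> 'w::len word ^ 4 \<Rightarrow> 'w word ^ 4" where
  "rot_vec r x = (\<chi> i. word_rotl r (x $ i))"

definition rot_mat :: "nat \<Rightarrow> 'w::len word ^ 4 ^ 4 \<Rightarrow> 'w word ^ 4 ^ 4" where
  "rot_mat r X = (\<chi> i j. word_rotl r (X $ i $ j))"

definition quarter_round ::
    "nat \<Rightarrow> nat \<Rightarrow> nat \<Rightarrow> nat \<Rightarrow> 'w::len word ^ 4 \<Rightarrow> 'w word ^ 4" where
  "quarter_round r1 r2 r3 r4 x =
    (let b0 = x $ 0 + x $ 1;
         b3 = word_rotl r1 (b0 XOR x $ 3);
         b2 = b3 + x $ 2;
         b1 = word_rotl r2 (b2 XOR x $ 1);
         y0 = b0 + b1;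
         y3 = word_rotl r3 (y0 XOR b3);
         y2 = y3 + b2;
         y1 = word_rotl r4 (y2 XOR b1)
     in \<chi> i. if i = 0 then y0 else if i = 1 then y1 else if i = 2 then y2 else y3)"

definition column_round ::
    "('w::len word ^ 4 \<Rightarrow> 'w word ^ 4) \<Rightarrow> 'w word ^ 4 ^ 4 \<Rightarrow> 'w word ^ 4 ^ 4" where
  "column_round Q X = (\<chi> k i. Q (\<chi> l. X $ l $ i) $ k)"

text \<open>The entry in row \<open>k\<close> and column \<open>j\<close> lies on the diagonal that starts in column \<open>j - k\<close>;
  see \<open>diagonal_round_nth\<close> below.\<close>

definition diagonal_round ::
    "('w::len word ^ 4 \<Rightarrow> 'w word ^ 4) \<Rightarrow> 'w word ^ 4 ^ 4 \<Rightarrow> 'w word ^ 4 ^ 4" where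
  "diagonal_round Q X = (\<chi> k j. Q (\<chi> l. X $ l $ ((j - k) + l)) $ k)"

lemma column_round_nth: "column_round Q X $ k $ i = Q (\<chi> l. X $ l $ i) $ k"
  by (simp add: column_round_def)

lemma diagonal_round_nth: "diagonal_round Q X $ k $ (i + k) = Q (\<chi> l. X $ l $ (i + l)) $ k"
  by (simp add: diagonal_round_def)

lemma index4_cases: "(i :: 4) = 0 \<or> i = 1 \<or> i = 2 \<or> i = 3"
  using exhaust_4[of i] by auto

end

theory Submission
  imports Defs
begin

text \<open>
  One round applies the quarter round independently to four disjoint lines of the matrix (its columns
  or its diagonals), and \<open>rot\<close> acts entrywise.  Hence the event for the round is the conjunction of the
  events for the four lines.  Rearranging a matrix into its lines is a bijection, so the lines are
  independent and uniform, and the probability for the round is exactly the fourth power of the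
  probability for the quarter round.
\<close>

lemma card_vec_components_in:
  fixes A :: "'a set"
  shows "card {v :: 'a ^ 'n::finite. \<forall>i. v $ i \<in> A} = card A ^ CARD('n)"
proof -
  have "bij_betw vec_nth {v :: 'a ^ 'n. \<forall>i. v $ i \<in> A} (\<Pi>\<^sub>E i\<in>UNIV. A)"
    by (rule bij_betw_byWitness[where f' = vec_lambda]) (auto simp: PiE_def)
  then have "card {v :: 'a ^ 'n. \<forall>i. v $ i \<in> A} = card (\<Pi>\<^sub>E i\<in>(UNIV :: 'n set). A)"
    by (rule bij_betw_same_card)
  then show ?thesis
    by (simp add: card_PiE)
qed

text \<open>Independence of the entries of a uniform vector, in counting form: numerator and
  denominator are both powers with exponent \<open>CARD('n)\<close>.\<close>

lemma prob_vec_components_in: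
  fixes A :: "'a::finite set"
  shows "measure_pmf.prob (pmf_of_set UNIV) {v :: 'a ^ 'n::finite. \<forall>i. v $ i \<in> A}
    = measure_pmf.prob (pmf_of_set UNIV) A ^ CARD('n)"
  by (simp add: measure_pmf_of_set card_vec_components_in power_divide)

text \<open>With \<open>c = (\<lambda>_. 0)\<close> the rows of \<open>lines c X\<close> are the columns of \<open>X\<close>, with \<open>c = (\<lambda>l. l)\<close> they are
  its diagonals.\<close>

definition lines where
  "lines c X = (\<chi> i l. X $ l $ (i + c l))"

lemma bij_lines:
  fixes c :: "'m::finite \<Rightarrow> 'n::{finite, group_add}"
  shows "bij (lines c)"
  \<comment> \<open>The witness solves \<open>j = i + c l\<close> for the line index
    \<open>i\<close>.\<close>
  by (rule bij_betw_byWitness[where f' = "\<lambda>Y. \<chi> l j. Y $ (j - c l) $ l"])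
    (auto simp: lines_def vec_eq_iff)

lemma lines_rot_mat: "lines c (rot_mat r X) $ i = rot_vec r (lines c X $ i)"
  by (simp add: lines_def rot_mat_def rot_vec_def vec_eq_iff)

lemma lines_column_round: "lines (\<lambda>_. 0) (column_round Q X) $ i = Q (lines (\<lambda>_. 0) X $ i)"
  by (simp add: lines_def column_round_nth vec_eq_iff)

lemma lines_diagonal_round: "lines (\<lambda>l. l) (diagonal_round Q X) $ i = Q (lines (\<lambda>l. l) X $ i)"
  by (simp add: lines_def diagonal_round_nth vec_eq_iff)

text \<open>Treats both kinds of round at once: \<open>lines_R\<close> says that \<open>R\<close>
  acts as \<open>Q\<close> on each line.\<close>

lemma prob_rot_commutes_round:
  fixes Q :: "'w::len word ^ 4 \<Rightarrow> 'w word ^ 4"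
  assumes lines_R: "\<And>X i. lines c (R X) $ i = Q (lines c X $ i)"
  shows "measure_pmf.prob (pmf_of_set UNIV) {X. rot_mat r (R X) = R (rot_mat r X)}
    = measure_pmf.prob (pmf_of_set UNIV) {x. rot_vec r (Q x) = Q (rot_vec r x)} ^ 4"
    (is "_ = measure_pmf.prob _ ?A ^ 4")
proof -
  have "rot_mat r (R X) = R (rot_mat r X) \<longleftrightarrow> (\<forall>i. lines c X $ i \<in> ?A)" for X
  proof -
    have "rot_mat r (R X) = R (rot_mat r X)
      \<longleftrightarrow> lines c (rot_mat r (R X)) = lines c (R (rot_mat r X))"
      by (rule inj_eq[OF bij_is_inj[OF bij_lines], symmetric])
    then show ?thesis
      \<comment> \<open>The instantiation splits the matrix equation into rows but leaves each row
        equation whole, in the form that defines the event for \<open>Q\<close>.\<close>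
      by (simp add: vec_eq_iff[of "lines c _"] lines_rot_mat lines_R)
  qed
  then have "{X. rot_mat r (R X) = R (rot_mat r X)} 
    = lines c -` {Y :: 'w word ^ 4 ^ 4. \<forall>i. Y $ i \<in> ?A}"
    by auto
  then have "measure_pmf.prob (pmf_of_set UNIV) {X. rot_mat r (R X) = R (rot_mat r X)}
    = measure_pmf.prob (map_pmf (lines c) (pmf_of_set UNIV)) {Y :: 'w word ^ 4 ^ 4. \<forall>i. Y $ i \<in> ?A}"
    by (simp only: measure_map_pmf)
  also have "map_pmf (lines c) (pmf_of_set UNIV) = pmf_of_set (UNIV :: ('w word ^ 4 ^ 4) set)"
    by (rule map_pmf_of_set_bij_betw[OF bij_lines]) simp_all
  finally have "measure_pmf.prob (pmf_of_set UNIV) {X. rot_mat r (R X) = R (rot_mat r X)}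
    = measure_pmf.prob (pmf_of_set UNIV) {Y :: 'w word ^ 4 ^ 4. \<forall>i. Y $ i \<in> ?A}" .
  then show ?thesis
    \<comment> \<open>Here the components are the four rows of \<open>Y\<close>, themselves
      vectors.\<close>
    by (simp only: prob_vec_components_in) simp
qed

theorem theorem2:
  fixes r r1 r2 r3 r4 :: nat
    and L U :: real
    and Q :: "'w::len word ^ 4 \<Rightarrow> 'w word ^ 4"
    and R :: "'w word ^ 4 ^ 4 \<Rightarrow> 'w word ^ 4 ^ 4"
  assumes "1 \<le> r" and "r \<le> LENGTH('w) - 1"
    and "r1 \<le> LENGTH('w) - 1" and "r2 \<le> LENGTH('w) - 1"
    and "r3 \<le> LENGTH('w) - 1" and "r4 \<le> LENGTH('w) - 1"
    and "Q = quarter_round r1 r2 r3 r4"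
    and "0 \<le> L" and "0 \<le> U"
    and "L \<le> measure_pmf.prob (pmf_of_set UNIV) {x. rot_vec r (Q x) = Q (rot_vec r x)}"
    and "measure_pmf.prob (pmf_of_set UNIV) {x. rot_vec r (Q x) = Q (rot_vec r x)} \<le> U"
    and "R = column_round Q \<or> R = diagonal_round Q"
  shows "L ^ 4 \<le> measure_pmf.prob (pmf_of_set UNIV) {X. rot_mat r (R X) = R (rot_mat r X)}
    \<and> measure_pmf.prob (pmf_of_set UNIV) {X. rot_mat r (R X) = R (rot_mat r X)} \<le> U ^ 4"
proof -
  have "measure_pmf.prob (pmf_of_set UNIV) {X. rot_mat r (R X) = R (rot_mat r X)}
    = measure_pmf.prob (pmf_of_set UNIV) {x. rot_vec r (Q x) = Q (rot_vec r x)} ^ 4"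
    using \<open>R = column_round Q \<or> R = diagonal_round Q\<close>
  proof
    assume "R = column_round Q"
    then show ?thesis
      by (intro prob_rot_commutes_round[where c = "\<lambda>_. 0"]) (simp add: lines_column_round)
  next
    assume "R = diagonal_round Q"
    then show ?thesis
      by (intro prob_rot_commutes_round[where c = "\<lambda>l. l"]) (simp add: lines_diagonal_round)
  qed
  \<comment> \<open>Monotonicity of the fourth power uses \<open>0 \<le> L\<close> for the lower
    bound and nonnegativity of the probability for the upper one.\<close>
  with assms show ?thesis
    by (simp add: power_mono)
qed

end
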